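(* Compacta and pseudo-invertible ambiguous representations form a category: taking compacta as objects, pseudo-invertible ambiguous representations $R\subset\exp X\times\exp Y$ as arrows $X\to Y$, and $R\mathbin{\bar\odot}S$ as the composite of $R:X\to Y$ and $S:Y\to Z$, composition is well defined and associative, and for each compactum $X$ the identity arrow is $\mathbf 1_X=\{(A,B)\in\exp X\times\exp X\mid A\subset B\}$. Moreover, the assignment that is the identity on objects and sends $R$ to $R^{\smile}$ is an involutive contravariant isomorphism of this category onto itself.
   Context: A compactum is a compact Hausdorff space. For a compactum $K$, $\exp K$ is the set of all non-empty closed subsets of $K$ with the Vietoris topology (base: $\langle U_1,\dots,U_n\rangle=\{F\in\exp K\mid F\subset U_1\cup\dots\cup U_n,\ F\cap U_i\neq\varnothing\ \forall i\}$, $U_i$ open in $K$). An ambiguous representation between compacta $X$ and $Y$ is a subset $R\subset\exp X\times\exp Y$ such that: (a) if $A'\subset A$, $B\subset B'$ ($A,A'\in\exp X$, $B,B'\in\exp Y$) and $(A,B)\in R$, then $(A',B')\in R$; (b) $(A,Y)\in R$ for all $A\in\exp X$; (c) for all $A\in\exp X$ the set $AR=\{B\in\exp Y\mid(A,B)\in R\}$ is closed in $\exp Y$. For an ambiguous representation $R\subset\exp X\times\exp Y$, the ambiguous representation $R^{\smile}\subset\exp Y\times\exp X$ is defined by: $(\tilde B,\tilde A)\in R^{\smile}$ if and only if for every $A\in\exp X$ with $A\cap\tilde A=\varnothing$ there is $B\in AR$ with $B\cap\tilde B=\varnothing$. $R$ is pseudo-invertible if $(R^{\smile})^{\smile}=R$.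 For ambiguous representations $R\subset\exp X\times\exp Y$ and $S\subset\exp Y\times\exp Z$, $R\odot S=\{(A,C)\mid\exists B\in\exp Y:\ (A,B)\in R,\ (B,C)\in S\}$ is the usual composition of relations, and $R\mathbin{\bar\odot}S\subset\exp X\times\exp Z$ is defined by $A(R\mathbin{\bar\odot}S)=\mathrm{Cl}(A(R\odot S))$ for all $A\in\exp X$, the closure being taken in $\exp Z$. *)

theory Defs
  imports "HOL-Analysis.Analysis"
begin

section \<open>Hyperspaces\<close>

definition hyperspace :: "'a topology \<Rightarrow> 'a set set" where
  "hyperspace K = {F. closedin K F \<and> F \<noteq> {}}"

definition vietoris_basic :: "'a topology \<Rightarrow> 'a set set \<Rightarrow> 'a set set" where
  "vietoris_basic K \<U> = {F \<in> hyperspace K. F \<subseteq> \<Union>\<U> \<and> (\<forall>U\<in>\<U>. F \<inter> U \<noteq> {})}"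

definition vietoris :: "'a topology \<Rightarrow> 'a set topology" where
  "vietoris K = topology_generated_by
     {vietoris_basic K \<U> | \<U>. finite \<U> \<and> (\<forall>U\<in>\<U>. openin K U)}"

lemma topspace_vietoris: "topspace (vietoris K) = hyperspace K"
proof -
  have "F \<in> vietoris_basic K {topspace K}" if "F \<in> hyperspace K" for F
    using that closedin_subset[of K F] by (auto simp: hyperspace_def vietoris_basic_def)
  moreover have "vietoris_basic K {topspace K}
      \<in> {vietoris_basic K \<U> | \<U>. finite \<U> \<and> (\<forall>U\<in>\<U>. openin K U)}"
    by (intro CollectI exI[of _ "{topspace K}"]) simp
  moreover have "vietoris_basic K \<U> \<subseteq> hyperspace K" for \<U>
    by (simp add: vietoris_basic_def)
  ultimately show ?thesis
    unfolding vietoris_def topology_generated_by_topspace by blast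
qed


section \<open>Ambiguous representations\<close>

text \<open>For \<open>A \<in> hyperspace X\<close> the set \<open>AR\<close> is the image \<open>R `` {A}\<close>.\<close>

definition ambiguous_rep :: "'a topology \<Rightarrow> 'b topology \<Rightarrow> ('a set \<times> 'b set) set \<Rightarrow> bool" where
  "ambiguous_rep X Y R \<longleftrightarrow>
     R \<subseteq> hyperspace X \<times> hyperspace Y \<and>
     (\<forall>A\<in>hyperspace X. \<forall>A'\<in>hyperspace X. \<forall>B\<in>hyperspace Y. \<forall>B'\<in>hyperspace Y.
        A' \<subseteq> A \<and> B \<subseteq> B' \<and> (A, B) \<in> R \<longrightarrow> (A', B') \<in> R) \<and>
     (\<forall>A\<in>hyperspace X. (A, topspace Y) \<in> R) \<and>
     (\<forall>A\<in>hyperspace X. closedin (vietoris Y) (R `` {A}))"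

definition smile ::
  "'a topology \<Rightarrow> 'b topology \<Rightarrow> ('a set \<times> 'b set) set \<Rightarrow> ('b set \<times> 'a set) set" where
  "smile X Y R = {(B', A'). B' \<in> hyperspace Y \<and> A' \<in> hyperspace X \<and>
     (\<forall>A\<in>hyperspace X. A \<inter> A' = {} \<longrightarrow> (\<exists>B\<in>R `` {A}. B \<inter> B' = {}))}"

text \<open>
  The pseudo-inverse is meant to be an ambiguous representation again. This holds automatically for
  nonempty spaces (lemma \<open>ambiguous_rep_smile\<close>), so there the second conjunct below is
  redundant. It matters only for the empty space: the empty relation is an ambiguous
  representation from the empty space to a nonempty \<open>Y\<close>, but there is none from \<open>Y\<close> to the
  empty space, as \<open>(B, {})\<close> can never belong to a relation between hyperspaces.
\<close>

definition pseudo_invertible ::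
  "'a topology \<Rightarrow> 'b topology \<Rightarrow> ('a set \<times> 'b set) set \<Rightarrow> bool" where
  "pseudo_invertible X Y R \<longleftrightarrow>
     ambiguous_rep X Y R \<and> ambiguous_rep Y X (smile X Y R) \<and> smile Y X (smile X Y R) = R"

lemma ambiguous_rep_smile:
  assumes X: "topspace X \<noteq> {}" and R: "ambiguous_rep X Y R"
  shows "ambiguous_rep Y X (smile X Y R)"
proof -
  have top: "topspace X \<in> hyperspace X"
    using X by (simp add: hyperspace_def)
  have sub: "A \<subseteq> topspace X" if "A \<in> hyperspace X" for A
    using that closedin_subset by (auto simp: hyperspace_def)
  have "closedin (vietoris X) (smile X Y R `` {B'})" if B': "B' \<in> hyperspace Y" for B'
  proof -
    define bad where "bad = {A \<in> hyperspace X. \<not> (\<exists>B\<in>R `` {A}. B \<inter> B' = {})}"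
    have "hyperspace X - smile X Y R `` {B'} = (\<Union>A\<in>bad. vietoris_basic X {topspace X - A})"
      (is "?L = ?R")
    proof
      show "?L \<subseteq> ?R"
      proof
        fix A' assume A': "A' \<in> ?L"
        then obtain A where A: "A \<in> bad" "A \<inter> A' = {}"
          using B' by (auto simp: smile_def bad_def)
        have "A' \<in> vietoris_basic X {topspace X - A}"
          using A A' sub[of A'] by (auto simp: vietoris_basic_def hyperspace_def)
        then show "A' \<in> ?R" using A by blast
      qed
      show "?R \<subseteq> ?L"
      proof
        fix A' assume "A' \<in> ?R"
        then obtain A where A: "A \<in> bad" and A': "A' \<in> hyperspace X" "A' \<subseteq> topspace X - A"
          by (auto simp: vietoris_basic_def)
        have "A \<inter> A' = {}" using A'(2) by blast
        then show "A' \<in> ?L" using A A'(1) by (auto simp: smile_def bad_def)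
      qed
    qed
    moreover have "openin (vietoris X) (vietoris_basic X {topspace X - A})" if "A \<in> bad" for A
    proof -
      have "openin X (topspace X - A)"
        using that by (auto simp: bad_def hyperspace_def)
      then have "vietoris_basic X {topspace X - A}
          \<in> {vietoris_basic X \<U> | \<U>. finite \<U> \<and> (\<forall>U\<in>\<U>. openin X U)}"
        by (intro CollectI exI[of _ "{topspace X - A}"]) simp
      then show ?thesis
        unfolding vietoris_def by (rule topology_generated_by_Basis)
    qed
    then have "openin (vietoris X) (\<Union>A\<in>bad. vietoris_basic X {topspace X - A})"
      by (intro openin_Union) blast
    ultimately have "openin (vietoris X) (topspace (vietoris X) - smile X Y R `` {B'})"
      by (simp only: topspace_vietoris)
    moreover have "smile X Y R `` {B'} \<subseteq> topspace (vietoris X)"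
      by (auto simp: topspace_vietoris smile_def)
    ultimately show ?thesis by (simp add: closedin_def)
  qed
  moreover have "(B, topspace X) \<in> smile X Y R" if "B \<in> hyperspace Y" for B
  proof -
    have "A \<inter> topspace X \<noteq> {}" if "A \<in> hyperspace X" for A
      using that sub[of A] by (auto simp: hyperspace_def)
    then show ?thesis using that top by (simp add: smile_def)
  qed
  moreover have "(B', A') \<in> smile X Y R"
    if "B' \<in> hyperspace Y" "A' \<in> hyperspace X" "B' \<subseteq> B" "A \<subseteq> A'" "(B, A) \<in> smile X Y R"
    for B B' A A'
  proof -
    have "\<exists>D\<in>R `` {C}. D \<inter> B' = {}" if "C \<in> hyperspace X" "C \<inter> A' = {}" for C
    proof -
      have "C \<inter> A = {}" using \<open>C \<inter> A' = {}\<close> \<open>A \<subseteq> A'\<close> by blast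
      then have "\<exists>D\<in>R `` {C}. D \<inter> B = {}"
        using \<open>(B, A) \<in> smile X Y R\<close> \<open>C \<in> hyperspace X\<close> by (simp add: smile_def)
      then obtain D where "D \<in> R `` {C}" "D \<inter> B = {}" ..
      moreover from this have "D \<inter> B' = {}" using \<open>B' \<subseteq> B\<close> by auto
      ultimately show ?thesis by (intro bexI[of _ D])
    qed
    then show ?thesis
      using \<open>B' \<in> hyperspace Y\<close> \<open>A' \<in> hyperspace X\<close> by (simp add: smile_def)
  qed
  moreover have "smile X Y R \<subseteq> hyperspace Y \<times> hyperspace X"
    by (auto simp: smile_def)
  ultimately show ?thesis
    unfolding ambiguous_rep_def by (intro conjI ballI impI) auto
qed

text \<open>The relational composite \<open>R \<odot> S\<close> is \<open>R O S\<close>.\<close>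

definition closed_comp ::
  "'a topology \<Rightarrow> 'c topology \<Rightarrow> ('a set \<times> 'b set) set \<Rightarrow> ('b set \<times> 'c set) set
     \<Rightarrow> ('a set \<times> 'c set) set" where
  "closed_comp X Z R S =
     {(A, C). A \<in> hyperspace X \<and> C \<in> vietoris Z closure_of ((R O S) `` {A})}"

definition id_rep :: "'a topology \<Rightarrow> ('a set \<times> 'a set) set" where
  "id_rep X = {(A, B). A \<in> hyperspace X \<and> B \<in> hyperspace X \<and> A \<subseteq> B}"


section \<open>Categories and contravariant isomorphisms\<close>

text \<open>
  Categories are given by hom-sets indexed by pairs of objects, which need not be disjoint.
  \<open>Comp X Y Z f g\<close> is the composite of \<open>f : X \<rightarrow> Y\<close> followed by \<open>g : Y \<rightarrow> Z\<close>.
\<close>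

locale hom_category =
  fixes Ob :: "'o set"
    and Hom :: "'o \<Rightarrow> 'o \<Rightarrow> 'm set"
    and Comp :: "'o \<Rightarrow> 'o \<Rightarrow> 'o \<Rightarrow> 'm \<Rightarrow> 'm \<Rightarrow> 'm"
    and Id :: "'o \<Rightarrow> 'm"
  assumes Comp_in_Hom:
      "\<lbrakk>X \<in> Ob; Y \<in> Ob; Z \<in> Ob; f \<in> Hom X Y; g \<in> Hom Y Z\<rbrakk> \<Longrightarrow> Comp X Y Z f g \<in> Hom X Z"
    and Comp_assoc:
      "\<lbrakk>X \<in> Ob; Y \<in> Ob; Z \<in> Ob; W \<in> Ob; f \<in> Hom X Y; g \<in> Hom Y Z; h \<in> Hom Z W\<rbrakk>
         \<Longrightarrow> Comp X Z W (Comp X Y Z f g) h = Comp X Y W f (Comp Y Z W g h)"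
    and Id_in_Hom: "X \<in> Ob \<Longrightarrow> Id X \<in> Hom X X"
    and Comp_Id_left: "\<lbrakk>X \<in> Ob; Y \<in> Ob; f \<in> Hom X Y\<rbrakk> \<Longrightarrow> Comp X X Y (Id X) f = f"
    and Comp_Id_right: "\<lbrakk>X \<in> Ob; Y \<in> Ob; f \<in> Hom X Y\<rbrakk> \<Longrightarrow> Comp X Y Y f (Id Y) = f"

locale contravariant_functor =
  C: hom_category Ob Hom Comp Id + D: hom_category Ob' Hom' Comp' Id'
  for Ob :: "'o set" and Hom :: "'o \<Rightarrow> 'o \<Rightarrow> 'm set" and Comp and Id
    and Ob' :: "'p set" and Hom' :: "'p \<Rightarrow> 'p \<Rightarrow> 'n set" and Comp' and Id' +
  fixes FO :: "'o \<Rightarrow> 'p" and FA :: "'o \<Rightarrow> 'o \<Rightarrow> 'm \<Rightarrow> 'n"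
  assumes FO_in_Ob: "X \<in> Ob \<Longrightarrow> FO X \<in> Ob'"
    and FA_in_Hom: "\<lbrakk>X \<in> Ob; Y \<in> Ob; f \<in> Hom X Y\<rbrakk> \<Longrightarrow> FA X Y f \<in> Hom' (FO Y) (FO X)"
    and FA_Id: "X \<in> Ob \<Longrightarrow> FA X X (Id X) = Id' (FO X)"
    and FA_Comp:
      "\<lbrakk>X \<in> Ob; Y \<in> Ob; Z \<in> Ob; f \<in> Hom X Y; g \<in> Hom Y Z\<rbrakk>
         \<Longrightarrow> FA X Z (Comp X Y Z f g) = Comp' (FO Z) (FO Y) (FO X) (FA Y Z g) (FA X Y f)"

locale contravariant_isomorphism = contravariant_functor +
  assumes bij_FO: "bij_betw FO Ob Ob'"
    and bij_FA: "\<lbrakk>X \<in> Ob; Y \<in> Ob\<rbrakk> \<Longrightarrow> bij_betw (FA X Y) (Hom X Y) (Hom' (FO Y) (FO X))"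

locale involutive_contravariant_isomorphism =
  contravariant_isomorphism Ob Hom Comp Id Ob Hom Comp Id FO FA
  for Ob :: "'o set" and Hom :: "'o \<Rightarrow> 'o \<Rightarrow> 'm set" and Comp and Id
    and FO :: "'o \<Rightarrow> 'o" and FA :: "'o \<Rightarrow> 'o \<Rightarrow> 'm \<Rightarrow> 'm" +
  assumes FO_FO: "X \<in> Ob \<Longrightarrow> FO (FO X) = X"
    and FA_FA: "\<lbrakk>X \<in> Ob; Y \<in> Ob; f \<in> Hom X Y\<rbrakk> \<Longrightarrow> FA (FO Y) (FO X) (FA X Y f) = f"


section \<open>Compacta and pseudo-invertible ambiguous representations\<close>

text \<open>
  The objects are the compacta whose points lie in the type \<open>'a\<close>, which is arbitrary and
  plays the role of the universe.
\<close>

definition compacta :: "'a topology set" where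
  "compacta = {X. compact_space X \<and> Hausdorff_space X}"

definition pinv_hom :: "'a topology \<Rightarrow> 'a topology \<Rightarrow> ('a set \<times> 'a set) set set" where
  "pinv_hom X Y = {R. pseudo_invertible X Y R}"

definition pinv_comp ::
  "'a topology \<Rightarrow> 'a topology \<Rightarrow> 'a topology \<Rightarrow> ('a set \<times> 'a set) set \<Rightarrow> ('a set \<times> 'a set) set
     \<Rightarrow> ('a set \<times> 'a set) set" where
  "pinv_comp X Y Z R S = closed_comp X Z R S"

end

theory Submission
  imports Defs
begin

text \<open>
  The Vietoris closure of an upward closed family \<open>F\<close> consists of those \<open>C\<close> for which every closed
  set disjoint from \<open>C\<close> is missed by some member of \<open>F\<close>. Hence both the pseudo-inverse and the
  closed composition can be expressed through disjointness of closed sets alone.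
  Pseudo-invertibility of \<open>R\<close> then says that, whenever \<open>(A, B) \<in> R\<close> and \<open>B\<close> misses \<open>B'\<close>, there is
  \<open>A'\<close> missing \<open>A\<close> with \<open>(B', A')\<close> in the pseudo-inverse: every closed set missing \<open>A'\<close> is related
  to some closed set missing \<open>B'\<close>. This interpolation is what allows the closure in an inner
  composite to be dropped, and what carries a composite over to its pseudo-inverse. That the
  identity arrows are their own pseudo-inverses follows by testing with one-point sets.
\<close>

section \<open>Hyperspaces and closures in the Vietoris topology\<close>

lemma topspace_in_hyperspace: "F \<in> hyperspace K \<Longrightarrow> topspace K \<in> hyperspace K"
  using closedin_subset by (fastforce simp: hyperspace_def)

lemma subset_topspace_if_hyperspace: "F \<in> hyperspace K \<Longrightarrow> F \<subseteq> topspace K"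
  by (simp add: hyperspace_def closedin_subset)

lemma Un_in_hyperspace: "F \<in> hyperspace K \<Longrightarrow> G \<in> hyperspace K \<Longrightarrow> F \<union> G \<in> hyperspace K"
  by (simp add: hyperspace_def closedin_Un)

lemma openin_vietoris_basic:
  assumes "finite \<U>" and "\<And>U. U \<in> \<U> \<Longrightarrow> openin K U"
  shows "openin (vietoris K) (vietoris_basic K \<U>)"
  unfolding vietoris_def using assms by (intro topology_generated_by_Basis) blast

text \<open>This extracts the upper half of a Vietoris neighbourhood. The property survives finite
  intersections and unions, so generators decide it; there \<open>V\<close> is the union of the
  defining open sets, because supersets of \<open>C\<close> inherit the conditions of meeting each
  of them.\<close>

lemma openin_vietoris_upper:
  assumes "openin (vietoris K) W" and "C \<in> W"
  obtains V where "openin K V" "C \<subseteq> V"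
    "\<And>D. D \<in> hyperspace K \<Longrightarrow> C \<subseteq> D \<Longrightarrow> D \<subseteq> V \<Longrightarrow> D \<in> W"
proof -
  have "generate_topology_on
     {vietoris_basic K \<U> | \<U>. finite \<U> \<and> (\<forall>U\<in>\<U>. openin K U)} W"
    using assms(1) unfolding vietoris_def by (simp add: openin_topology_generated_by_iff)
  then have "\<exists>V. openin K V \<and> C \<subseteq> V \<and>
      (\<forall>D\<in>hyperspace K. C \<subseteq> D \<and> D \<subseteq> V \<longrightarrow> D \<in> W)"
    using \<open>C \<in> W\<close>
  proof (induction rule: generate_topology_on.induct)
    case Empty
    then show ?case by simp
  next
    case (Int a b)
    then obtain V V' where "openin K V" "C \<subseteq> V" "openin K V'" "C \<subseteq> V'"
      "\<forall>D\<in>hyperspace K. C \<subseteq> D \<and> D \<subseteq> V \<longrightarrow> D \<in> a"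
      "\<forall>D\<in>hyperspace K. C \<subseteq> D \<and> D \<subseteq> V' \<longrightarrow> D \<in> b"
      by auto
    then show ?case by (intro exI[of _ "V \<inter> V'"]) auto
  next
    case (UN \<K>)
    then show ?case by (meson UnionE UnionI)
  next
    case (Basis s)
    then obtain \<U> where \<U>: "\<And>U. U \<in> \<U> \<Longrightarrow> openin K U" and s: "s = vietoris_basic K \<U>"
      by blast
    have C: "C \<subseteq> \<Union>\<U>" "\<And>U. U \<in> \<U> \<Longrightarrow> C \<inter> U \<noteq> {}"
      using Basis.prems by (auto simp: s vietoris_basic_def)
    have "D \<in> s" if "D \<in> hyperspace K" "C \<subseteq> D" "D \<subseteq> \<Union>\<U>" for D
      unfolding s vietoris_basic_def using that C(2) by blast
    then show ?case using C(1) \<U> by (intro exI[of _ "\<Union>\<U>"]) blast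
  qed
  then obtain V where "openin K V" "C \<subseteq> V"
    "\<forall>D\<in>hyperspace K. C \<subseteq> D \<and> D \<subseteq> V \<longrightarrow> D \<in> W"
    by (elim exE conjE)
  then show thesis by (intro that[of V]) simp_all
qed

text \<open>Only the upper half of the topology matters for an upward closed family: once some
  member lies inside the open set \<open>V\<close> around \<open>C\<close>, enlarging it by
  \<open>C\<close> restores all the conditions of meeting open sets.\<close>

lemma vietoris_closure_of_upset:
  assumes sub: "F \<subseteq> hyperspace K" and top: "topspace K \<in> F"
    and up: "\<And>A B. A \<in> F \<Longrightarrow> B \<in> hyperspace K \<Longrightarrow> A \<subseteq> B \<Longrightarrow> B \<in> F"
  shows "vietoris K closure_of F =
    {C \<in> hyperspace K. \<forall>D\<in>hyperspace K. D \<inter> C = {} \<longrightarrow> (\<exists>A\<in>F. A \<inter> D = {})}"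
    (is "_ = ?R")
proof (intro equalityI subsetI)
  fix C assume "C \<in> vietoris K closure_of F"
  then have C: "C \<in> hyperspace K"
    and meet: "\<And>W. C \<in> W \<Longrightarrow> openin (vietoris K) W \<Longrightarrow> \<exists>A\<in>F. A \<in> W"
    unfolding in_closure_of topspace_vietoris by blast+
  have "\<exists>A\<in>F. A \<inter> D = {}" if "D \<in> hyperspace K" "D \<inter> C = {}" for D
  proof -
    \<comment> \<open>This basic open set consists of the non-empty closed sets missing
      \<open>D\<close>, and \<open>C\<close> is one of them.\<close>
    have "openin (vietoris K) (vietoris_basic K {topspace K - D})"
      using \<open>D \<in> hyperspace K\<close> by (intro openin_vietoris_basic) (auto simp: hyperspace_def)
    moreover have "C \<in> vietoris_basic K {topspace K - D}"
      using that C subset_topspace_if_hyperspace[OF C]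
      by (auto simp: vietoris_basic_def hyperspace_def)
    ultimately obtain A where "A \<in> F" "A \<in> vietoris_basic K {topspace K - D}"
      using meet by blast
    then show ?thesis by (auto simp: vietoris_basic_def)
  qed
  with C show "C \<in> ?R" by blast
next
  fix C assume "C \<in> ?R"
  then have C: "C \<in> hyperspace K"
    and miss: "\<And>D. D \<in> hyperspace K \<Longrightarrow> D \<inter> C = {} \<Longrightarrow> \<exists>A\<in>F. A \<inter> D = {}"
    by auto
  have "\<exists>A\<in>F. A \<in> W" if "C \<in> W" and "openin (vietoris K) W" for W
  proof -
    obtain V where V: "openin K V" "C \<subseteq> V"
      and W: "\<And>D. D \<in> hyperspace K \<Longrightarrow> C \<subseteq> D \<Longrightarrow> D \<subseteq> V \<Longrightarrow> D \<in> W"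
      using openin_vietoris_upper \<open>openin (vietoris K) W\<close> \<open>C \<in> W\<close> by metis
    \<comment> \<open>The test set is the complement of \<open>V\<close>. If it is empty it is no
      point of the hyperspace, and then the whole space serves as \<open>A\<close>.\<close>
    have "\<exists>A\<in>F. A \<inter> (topspace K - V) = {}"
    proof (cases "topspace K - V = {}")
      case False
      then have "topspace K - V \<in> hyperspace K"
        using V(1) by (auto simp: hyperspace_def)
      then show ?thesis using miss V(2) by blast
    qed (use top in auto)
    then obtain A where A: "A \<in> F" "A \<inter> (topspace K - V) = {}" ..
    have hA: "A \<in> hyperspace K" using A(1) sub by blast
    then have hAC: "A \<union> C \<in> hyperspace K" using C by (rule Un_in_hyperspace)
    have "A \<union> C \<in> F" using up[OF A(1) hAC] by blast
    moreover have "A \<subseteq> V" using A(2) subset_topspace_if_hyperspace[OF hA] by blast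
    then have "A \<union> C \<in> W" using W[OF hAC] V(2) by blast
    ultimately show ?thesis by blast
  qed
  with C show "C \<in> vietoris K closure_of F"
    unfolding in_closure_of topspace_vietoris by blast
qed

section \<open>Working forms of the axioms of an ambiguous representation\<close>

lemma ambiguous_rep_hyperspace:
  assumes "ambiguous_rep X Y R" "(A, B) \<in> R"
  shows "A \<in> hyperspace X" "B \<in> hyperspace Y"
proof -
  have "R \<subseteq> hyperspace X \<times> hyperspace Y"
    using assms(1) unfolding ambiguous_rep_def by (elim conjE)
  with assms(2) show "A \<in> hyperspace X" "B \<in> hyperspace Y" by auto
qed

lemma ambiguous_rep_mono:
  assumes R: "ambiguous_rep X Y R" "(A, B) \<in> R"
    and "A' \<in> hyperspace X" "A' \<subseteq> A" "B' \<in> hyperspace Y" "B \<subseteq> B'"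
  shows "(A', B') \<in> R"
proof -
  have "\<forall>A\<in>hyperspace X. \<forall>A'\<in>hyperspace X. \<forall>B\<in>hyperspace Y. \<forall>B'\<in>hyperspace Y.
      A' \<subseteq> A \<and> B \<subseteq> B' \<and> (A, B) \<in> R \<longrightarrow> (A', B') \<in> R"
    using R(1) unfolding ambiguous_rep_def by (elim conjE)
  from this[rule_format, OF ambiguous_rep_hyperspace(1)[OF R] assms(3)
      ambiguous_rep_hyperspace(2)[OF R] assms(5)]
  show ?thesis using assms(2,4,6) by simp
qed

lemma ambiguous_rep_top:
  assumes "ambiguous_rep X Y R" "A \<in> hyperspace X"
  shows "(A, topspace Y) \<in> R"
  using assms unfolding ambiguous_rep_def by (elim conjE) (rule bspec)

lemma ambiguous_rep_closed:
  assumes R: "ambiguous_rep X Y R" and A: "A \<in> hyperspace X" and B: "B \<in> hyperspace Y"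
    and miss: "\<And>D. D \<in> hyperspace Y \<Longrightarrow> D \<inter> B = {} \<Longrightarrow> \<exists>B'. (A, B') \<in> R \<and> B' \<inter> D = {}"
  shows "(A, B) \<in> R"
proof -
  have "closedin (vietoris Y) (R `` {A})"
    using R A unfolding ambiguous_rep_def by (elim conjE) (rule bspec)
  then have "vietoris Y closure_of (R `` {A}) = R `` {A}"
    by (rule closure_of_closedin)
  moreover have "vietoris Y closure_of (R `` {A}) =
      {C \<in> hyperspace Y. \<forall>D\<in>hyperspace Y. D \<inter> C = {} \<longrightarrow> (\<exists>A\<in>R `` {A}. A \<inter> D = {})}"
  proof (rule vietoris_closure_of_upset)
    show "R `` {A} \<subseteq> hyperspace Y" using ambiguous_rep_hyperspace[OF R] by blast
    show "topspace Y \<in> R `` {A}" using ambiguous_rep_top[OF R A] by simp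
    show "C' \<in> R `` {A}" if "C \<in> R `` {A}" "C' \<in> hyperspace Y" "C \<subseteq> C'" for C C'
      using that ambiguous_rep_mono[OF R _ A] by blast
  qed
  ultimately have "R `` {A} = {C \<in> hyperspace Y. \<forall>D\<in>hyperspace Y.
      D \<inter> C = {} \<longrightarrow> (\<exists>A\<in>R `` {A}. A \<inter> D = {})}"
    by (rule trans[OF sym])
  moreover have "B \<in> \<dots>"
    using B miss by blast
  ultimately have "B \<in> R `` {A}" by (rule ssubst)
  then show ?thesis by simp
qed

section \<open>Pseudo-inverse and closed composition in terms of disjointness\<close>

lemma smile_iff:
  "(B', A') \<in> smile X Y R \<longleftrightarrow> B' \<in> hyperspace Y \<and> A' \<in> hyperspace X \<and>
     (\<forall>A\<in>hyperspace X. A \<inter> A' = {} \<longrightarrow> (\<exists>B. (A, B) \<in> R \<and> B \<inter> B' = {}))"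
  by (simp add: smile_def Bex_def)

lemma relcomp_upset:
  assumes R: "ambiguous_rep X Y R" and S: "ambiguous_rep Y Z S" and A: "A \<in> hyperspace X"
  shows "(R O S) `` {A} \<subseteq> hyperspace Z" "topspace Z \<in> (R O S) `` {A}"
    "\<And>C C'. C \<in> (R O S) `` {A} \<Longrightarrow> C' \<in> hyperspace Z \<Longrightarrow> C \<subseteq> C' \<Longrightarrow> C' \<in> (R O S) `` {A}"
proof -
  show "(R O S) `` {A} \<subseteq> hyperspace Z"
    using ambiguous_rep_hyperspace[OF S] by blast
  have "(A, topspace Y) \<in> R" using R A by (rule ambiguous_rep_top)
  \<comment> \<open>\<open>topspace Y\<close> is non-empty because it already occurs as a value of
    \<open>R\<close>.\<close>
  moreover from this have "(topspace Y, topspace Z) \<in> S"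
    by (intro ambiguous_rep_top[OF S] ambiguous_rep_hyperspace[OF R])
  ultimately show "topspace Z \<in> (R O S) `` {A}" by blast
  fix C C' assume "C \<in> (R O S) `` {A}" "C' \<in> hyperspace Z" "C \<subseteq> C'"
  then obtain B where B: "(A, B) \<in> R" "(B, C) \<in> S" by blast
  have "(B, C') \<in> S"
    using ambiguous_rep_hyperspace(1)[OF S B(2)] order_refl \<open>C' \<in> hyperspace Z\<close> \<open>C \<subseteq> C'\<close>
    by (rule ambiguous_rep_mono[OF S B(2)])
  with B(1) show "C' \<in> (R O S) `` {A}" by blast
qed

lemma closed_comp_iff:
  assumes R: "ambiguous_rep X Y R" and S: "ambiguous_rep Y Z S"
  shows "(A, C) \<in> closed_comp X Z R S \<longleftrightarrow> A \<in> hyperspace X \<and> C \<in> hyperspace Z \<and>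
    (\<forall>D\<in>hyperspace Z. D \<inter> C = {} \<longrightarrow> (\<exists>B C'. (A, B) \<in> R \<and> (B, C') \<in> S \<and> C' \<inter> D = {}))"
proof (cases "A \<in> hyperspace X")
  case True
  have "vietoris Z closure_of ((R O S) `` {A}) = {C \<in> hyperspace Z. \<forall>D\<in>hyperspace Z.
      D \<inter> C = {} \<longrightarrow> (\<exists>C'\<in>(R O S) `` {A}. C' \<inter> D = {})}"
    using relcomp_upset[OF R S True] by (rule vietoris_closure_of_upset)
  moreover have "(\<exists>C'\<in>(R O S) `` {A}. C' \<inter> D = {}) \<longleftrightarrow>
      (\<exists>B C'. (A, B) \<in> R \<and> (B, C') \<in> S \<and> C' \<inter> D = {})" for D
    by blast
  ultimately show ?thesis
    using True by (simp only: closed_comp_def mem_Collect_eq case_prod_conv)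
qed (simp add: closed_comp_def)

lemma ambiguous_rep_closed_comp:
  assumes R: "ambiguous_rep X Y R" and S: "ambiguous_rep Y Z S"
  shows "ambiguous_rep X Z (closed_comp X Z R S)"
  unfolding ambiguous_rep_def
proof (intro conjI ballI impI)
  show "closed_comp X Z R S \<subseteq> hyperspace X \<times> hyperspace Z"
    using closed_comp_iff[OF R S] by auto
next
  fix A A' C C'
  assume h: "A \<in> hyperspace X" "A' \<in> hyperspace X" "C \<in> hyperspace Z" "C' \<in> hyperspace Z"
    and *: "A' \<subseteq> A \<and> C \<subseteq> C' \<and> (A, C) \<in> closed_comp X Z R S"
  have "\<exists>B E. (A', B) \<in> R \<and> (B, E) \<in> S \<and> E \<inter> D = {}"
    if "D \<in> hyperspace Z" "D \<inter> C' = {}" for D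
  proof -
    \<comment> \<open>A test set for the larger \<open>C'\<close> is also one for \<open>C\<close>,
      and the intermediate \<open>B\<close> can be kept when \<open>A\<close> shrinks to
      \<open>A'\<close>.\<close>
    have "D \<inter> C = {}" using that * by blast
    with * \<open>D \<in> hyperspace Z\<close>
    obtain B E where B: "(A, B) \<in> R" and E: "(B, E) \<in> S" "E \<inter> D = {}"
      unfolding closed_comp_iff[OF R S] by blast
    have "A' \<subseteq> A" using * by blast
    then have "(A', B) \<in> R"
      using ambiguous_rep_hyperspace(2)[OF R B] order_refl
      by (rule ambiguous_rep_mono[OF R B h(2)])
    with E show ?thesis by blast
  qed
  with h show "(A', C') \<in> closed_comp X Z R S"
    unfolding closed_comp_iff[OF R S] by blast
next
  fix A assume A: "A \<in> hyperspace X"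
  have "closed_comp X Z R S `` {A} = vietoris Z closure_of ((R O S) `` {A})"
    using A by (auto simp: closed_comp_def)
  then show "closedin (vietoris Z) (closed_comp X Z R S `` {A})" by simp
  have "(R O S) `` {A} \<subseteq> vietoris Z closure_of ((R O S) `` {A})"
    using relcomp_upset(1)[OF R S A] by (intro closure_of_subset) (simp add: topspace_vietoris)
  then show "(A, topspace Z) \<in> closed_comp X Z R S"
    using A relcomp_upset(2)[OF R S A] unfolding closed_comp_def by blast
qed

section \<open>Pseudo-invertible representations: interpolation, composites, associativity\<close>

lemma pseudo_invertibleD:
  assumes "pseudo_invertible X Y R"
  shows "ambiguous_rep X Y R" "ambiguous_rep Y X (smile X Y R)"
    "smile Y X (smile X Y R) = R"
  using assms by (auto simp: pseudo_invertible_def)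

lemma pseudo_invertible_smile:
  "pseudo_invertible X Y R \<Longrightarrow> pseudo_invertible Y X (smile X Y R)"
  by (simp add: pseudo_invertible_def)

text \<open>Read \<open>R\<close> as the pseudo-inverse of \<open>smile X Y R\<close> and use
  \<open>B'\<close> as the test set for the pair \<open>(A, B)\<close>.\<close>

lemma pseudo_invertible_interpolate:
  assumes "pseudo_invertible X Y R" "(A, B) \<in> R" "B' \<in> hyperspace Y" "B' \<inter> B = {}"
  obtains A' where "(B', A') \<in> smile X Y R" "A' \<inter> A = {}"
  using assms pseudo_invertibleD(3)[OF assms(1)] smile_iff[of A B Y X "smile X Y R"] by metis

text \<open>From left to right, interpolation first in \<open>S\<close> and then in \<open>R\<close>
  carries disjointness back from \<open>Z\<close> to \<open>X\<close>. From right to left, the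
  definitions of the two pseudo-inverses carry it forward.\<close>

lemma smile_closed_comp:
  assumes R: "pseudo_invertible X Y R" and S: "pseudo_invertible Y Z S"
  shows "smile X Z (closed_comp X Z R S) = closed_comp Z X (smile Y Z S) (smile X Y R)"
proof -
  note aR = pseudo_invertibleD(1)[OF R] and aS = pseudo_invertibleD(1)[OF S]
    and bR = pseudo_invertibleD(2)[OF R] and bS = pseudo_invertibleD(2)[OF S]
  have "(C', A') \<in> smile X Z (closed_comp X Z R S) \<longleftrightarrow>
      (C', A') \<in> closed_comp Z X (smile Y Z S) (smile X Y R)" for C' A'
  proof
    assume L: "(C', A') \<in> smile X Z (closed_comp X Z R S)"
    then have h: "C' \<in> hyperspace Z" "A' \<in> hyperspace X" by (auto simp: smile_iff)
    have "\<exists>B' A0. (C', B') \<in> smile Y Z S \<and> (B', A0) \<in> smile X Y R \<and> A0 \<inter> A = {}"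
      if A: "A \<in> hyperspace X" "A \<inter> A' = {}" for A
    proof -
      from L A obtain C where C: "(A, C) \<in> closed_comp X Z R S" "C \<inter> C' = {}"
        by (auto simp: smile_iff)
      \<comment> \<open>Since \<open>C'\<close> misses \<open>C\<close>, it is a test set for the
        closure; it replaces the limit value \<open>C\<close> by a value \<open>E\<close> of the
        relational composite.\<close>
      then obtain B E where B: "(A, B) \<in> R" and E: "(B, E) \<in> S" "E \<inter> C' = {}"
        using h(1) unfolding closed_comp_iff[OF aR aS] by (metis Int_commute)
      obtain B' where B': "(C', B') \<in> smile Y Z S" "B' \<inter> B = {}"
        using pseudo_invertible_interpolate[OF S E(1) h(1)] E(2) by (metis Int_commute)
      then have "B' \<in> hyperspace Y" by (simp add: smile_iff)
      then obtain A0 where "(B', A0) \<in> smile X Y R" "A0 \<inter> A = {}"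
        using B'(2) by (rule pseudo_invertible_interpolate[OF R B])
      with B'(1) show ?thesis by blast
    qed
    with h show "(C', A') \<in> closed_comp Z X (smile Y Z S) (smile X Y R)"
      unfolding closed_comp_iff[OF bS bR] by blast
  next
    assume L: "(C', A') \<in> closed_comp Z X (smile Y Z S) (smile X Y R)"
    then have h: "C' \<in> hyperspace Z" "A' \<in> hyperspace X"
      by (auto simp: closed_comp_iff[OF bS bR])
    have "\<exists>C. (A, C) \<in> closed_comp X Z R S \<and> C \<inter> C' = {}"
      if A: "A \<in> hyperspace X" "A \<inter> A' = {}" for A
    proof -
      from L A obtain B' A0 where B': "(C', B') \<in> smile Y Z S"
        and A0: "(B', A0) \<in> smile X Y R" "A0 \<inter> A = {}"
        unfolding closed_comp_iff[OF bS bR] by metis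
      from A0 A(1) obtain B where B: "(A, B) \<in> R" "B \<inter> B' = {}"
        unfolding smile_iff by (metis Int_commute)
      moreover have "B \<in> hyperspace Y" using aR B(1) by (rule ambiguous_rep_hyperspace)
      ultimately obtain C where C: "(B, C) \<in> S" "C \<inter> C' = {}"
        using B' unfolding smile_iff by blast
      \<comment> \<open>The pair lies in the relational composite already, so the same
        \<open>B\<close> and \<open>C\<close> answer every test set.\<close>
      have "(A, C) \<in> closed_comp X Z R S"
        unfolding closed_comp_iff[OF aR aS]
        using A(1) B(1) C(1) ambiguous_rep_hyperspace[OF aS C(1)] by (metis Int_commute)
      with C(2) show ?thesis by blast
    qed
    with h show "(C', A') \<in> smile X Z (closed_comp X Z R S)"
      unfolding smile_iff by blast
  qed
  then show ?thesis by auto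
qed

text \<open>Pseudo-inversion reverses composites, so applying it twice returns the factors, each
  fixed by double pseudo-inversion, in their original order.\<close>

lemma pseudo_invertible_closed_comp:
  assumes R: "pseudo_invertible X Y R" and S: "pseudo_invertible Y Z S"
  shows "pseudo_invertible X Z (closed_comp X Z R S)"
  unfolding pseudo_invertible_def
proof (intro conjI)
  note smileT = smile_closed_comp[OF R S]
  show "ambiguous_rep X Z (closed_comp X Z R S)"
    using pseudo_invertibleD(1)[OF R] pseudo_invertibleD(1)[OF S]
    by (rule ambiguous_rep_closed_comp)
  show "ambiguous_rep Z X (smile X Z (closed_comp X Z R S))"
    unfolding smileT using pseudo_invertibleD(2)[OF S] pseudo_invertibleD(2)[OF R]
    by (rule ambiguous_rep_closed_comp)
  show "smile Z X (smile X Z (closed_comp X Z R S)) = closed_comp X Z R S"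
    unfolding smileT
      smile_closed_comp[OF pseudo_invertible_smile[OF S] pseudo_invertible_smile[OF R]]
    by (simp only: pseudo_invertibleD(3)[OF R] pseudo_invertibleD(3)[OF S])
qed

text \<open>Both sides are closures, so it suffices to compare which test sets \<open>D\<close> in
  \<open>W\<close> are missed. The delicate direction is the one where \<open>(A, C)\<close> lies
  only in the closure of the inner composite.\<close>

lemma closed_comp_assoc:
  assumes R: "ambiguous_rep X Y R" and S: "ambiguous_rep Y Z S" and P: "pseudo_invertible Z W P"
  shows "closed_comp X W (closed_comp X Z R S) P = closed_comp X W R (closed_comp Y W S P)"
proof -
  note aP = pseudo_invertibleD(1)[OF P]
  note RS = ambiguous_rep_closed_comp[OF R S] and SP = ambiguous_rep_closed_comp[OF S aP]
  have "(\<exists>C E. (A, C) \<in> closed_comp X Z R S \<and> (C, E) \<in> P \<and> E \<inter> D = {}) \<longleftrightarrow>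
      (\<exists>B E. (A, B) \<in> R \<and> (B, E) \<in> closed_comp Y W S P \<and> E \<inter> D = {})" (is "?l \<longleftrightarrow> ?r")
    if D: "D \<in> hyperspace W" for A D
  proof
    assume ?l
    then obtain C E where C: "(A, C) \<in> closed_comp X Z R S" and E: "(C, E) \<in> P" "D \<inter> E = {}"
      by blast
    \<comment> \<open>\<open>C'\<close> transports the test set \<open>D\<close> back to
      \<open>Z\<close>: a value \<open>C0\<close> of the relational composite missing
      \<open>C'\<close> can replace \<open>C\<close>, since \<open>P\<close> relates it to a set
      missing \<open>D\<close>.\<close>
    obtain C' where C': "(D, C') \<in> smile Z W P" "C' \<inter> C = {}"
      using P E(1) D E(2) by (rule pseudo_invertible_interpolate)
    then have "C' \<in> hyperspace Z" by (simp add: smile_iff)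
    then obtain B C0 where B: "(A, B) \<in> R" and C0: "(B, C0) \<in> S" "C0 \<inter> C' = {}"
      using C C'(2) unfolding closed_comp_iff[OF R S] by blast
    then obtain E0 where E0: "(C0, E0) \<in> P" "E0 \<inter> D = {}"
      using C'(1) ambiguous_rep_hyperspace[OF S C0(1)] unfolding smile_iff by blast
    have "(B, E0) \<in> closed_comp Y W S P"
      unfolding closed_comp_iff[OF S aP]
      using C0(1) E0(1) ambiguous_rep_hyperspace[OF S C0(1)] ambiguous_rep_hyperspace[OF aP E0(1)]
      by (metis Int_commute)
    with B E0(2) show ?r by blast
  next
    assume ?r
    then obtain B E where B: "(A, B) \<in> R" and E: "(B, E) \<in> closed_comp Y W S P" "D \<inter> E = {}"
      by blast
    then obtain C E0 where C: "(B, C) \<in> S" and E0: "(C, E0) \<in> P" "E0 \<inter> D = {}"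
      using D unfolding closed_comp_iff[OF S aP] by blast
    have "(A, C) \<in> closed_comp X Z R S"
      unfolding closed_comp_iff[OF R S]
      using B C ambiguous_rep_hyperspace[OF R B] ambiguous_rep_hyperspace[OF S C]
      by (metis Int_commute)
    with E0 show ?l by blast
  qed
  then show ?thesis
    by (auto simp: closed_comp_iff[OF RS aP] closed_comp_iff[OF R SP])
qed

section \<open>Identity arrows\<close>

lemma singleton_in_hyperspace: "t1_space X \<Longrightarrow> x \<in> topspace X \<Longrightarrow> {x} \<in> hyperspace X"
  by (simp add: hyperspace_def closedin_t1_singleton)

lemma smile_id_rep:
  assumes X: "t1_space X"
  shows "smile X X (id_rep X) = id_rep X"
proof -
  have "(B', A') \<in> smile X X (id_rep X) \<longleftrightarrow> (B', A') \<in> id_rep X" for A' B'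
  proof
    assume L: "(B', A') \<in> smile X X (id_rep X)"
    have "x \<in> A'" if "x \<in> B'" for x
    proof (rule ccontr)
      assume "x \<notin> A'"
      moreover have "{x} \<in> hyperspace X"
        using L \<open>x \<in> B'\<close> subset_topspace_if_hyperspace
        by (intro singleton_in_hyperspace[OF X]) (auto simp: smile_iff)
      \<comment> \<open>A set \<open>B\<close> above \<open>{x}\<close> contains \<open>x\<close>,
        which is in \<open>B'\<close>, so it cannot miss \<open>B'\<close>.\<close>
      ultimately obtain B where "({x}, B) \<in> id_rep X" "B \<inter> B' = {}"
        using L unfolding smile_iff by blast
      with \<open>x \<in> B'\<close> show False by (auto simp: id_rep_def)
    qed
    with L show "(B', A') \<in> id_rep X" by (auto simp: smile_iff id_rep_def)
  next
    assume "(B', A') \<in> id_rep X"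
    \<comment> \<open>Each test set missing \<open>A'\<close> misses the smaller \<open>B'\<close>
      and is its own witness.\<close>
    then show "(B', A') \<in> smile X X (id_rep X)"
      unfolding smile_iff id_rep_def by blast
  qed
  then show ?thesis by auto
qed

text \<open>Closedness of the images comes from \<open>smile_id_rep\<close>: the disjointness
  description of the closure puts it inside an image under the pseudo-inverse, which is the identity
  arrow again.\<close>

lemma ambiguous_rep_id_rep:
  assumes X: "t1_space X"
  shows "ambiguous_rep X X (id_rep X)"
  unfolding ambiguous_rep_def
proof (intro conjI ballI impI)
  fix A assume A: "A \<in> hyperspace X"
  have sub: "id_rep X `` {A} \<subseteq> hyperspace X" and top: "topspace X \<in> id_rep X `` {A}"
    using A topspace_in_hyperspace[OF A] subset_topspace_if_hyperspace[OF A]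
    by (auto simp: id_rep_def)
  from top show "(A, topspace X) \<in> id_rep X" by simp
  have "vietoris X closure_of (id_rep X `` {A}) = {C \<in> hyperspace X. \<forall>D\<in>hyperspace X.
      D \<inter> C = {} \<longrightarrow> (\<exists>B\<in>id_rep X `` {A}. B \<inter> D = {})}"
    using sub top by (rule vietoris_closure_of_upset) (auto simp: id_rep_def)
  also have "\<dots> \<subseteq> smile X X (id_rep X) `` {A}"
  proof
    fix C
    assume C: "C \<in> {C \<in> hyperspace X. \<forall>D\<in>hyperspace X.
      D \<inter> C = {} \<longrightarrow> (\<exists>B\<in>id_rep X `` {A}. B \<inter> D = {})}"
    \<comment> \<open>\<open>A\<close> lies inside some \<open>B\<close> missing \<open>D\<close>,
      so \<open>D\<close> misses \<open>A\<close> and can itself be the witness required by the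
      pseudo-inverse.\<close>
    have "(D, D) \<in> id_rep X \<and> D \<inter> A = {}" if D: "D \<in> hyperspace X" "D \<inter> C = {}" for D
    proof -
      from C D obtain B where "(A, B) \<in> id_rep X" "B \<inter> D = {}" by blast
      with D(1) show ?thesis unfolding id_rep_def by blast
    qed
    with A C show "C \<in> smile X X (id_rep X) `` {A}"
      unfolding Image_singleton_iff smile_iff by blast
  qed
  finally have "vietoris X closure_of (id_rep X `` {A}) \<subseteq> id_rep X `` {A}"
    unfolding smile_id_rep[OF X] .
  then show "closedin (vietoris X) (id_rep X `` {A})"
    using sub by (simp add: closure_of_subset_eq[symmetric] topspace_vietoris)
qed (auto simp: id_rep_def)

text \<open>Antitonicity of \<open>R\<close> in its first argument absorbs the step from
  \<open>A\<close> to a larger \<open>B\<close>; closedness of the images of \<open>R\<close>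
  absorbs the closure.\<close>

lemma closed_comp_id_rep_left:
  assumes X: "t1_space X" and R: "ambiguous_rep X Y R"
  shows "closed_comp X Y (id_rep X) R = R"
proof -
  note I = ambiguous_rep_id_rep[OF X]
  have "(A, C) \<in> closed_comp X Y (id_rep X) R \<longleftrightarrow> (A, C) \<in> R" for A C
  proof
    assume L: "(A, C) \<in> closed_comp X Y (id_rep X) R"
    show "(A, C) \<in> R"
    proof (rule ambiguous_rep_closed[OF R])
      fix D assume "D \<in> hyperspace Y" "D \<inter> C = {}"
      with L obtain B C' where B: "(A, B) \<in> id_rep X" "(B, C') \<in> R" "C' \<inter> D = {}"
        unfolding closed_comp_iff[OF I R] by blast
      have "A \<in> hyperspace X" "A \<subseteq> B" using B(1) by (auto simp: id_rep_def)
      then have "(A, C') \<in> R"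
        using ambiguous_rep_hyperspace(2)[OF R B(2)] order_refl
        by (rule ambiguous_rep_mono[OF R B(2)])
      with B(3) show "\<exists>B'. (A, B') \<in> R \<and> B' \<inter> D = {}" by blast
    qed (use L closed_comp_iff[OF I R] in auto)
  next
    assume AC: "(A, C) \<in> R"
    note h = ambiguous_rep_hyperspace[OF R AC]
    have "(A, A) \<in> id_rep X" using h(1) by (simp add: id_rep_def)
    then show "(A, C) \<in> closed_comp X Y (id_rep X) R"
      using AC h unfolding closed_comp_iff[OF I R] by (metis Int_commute)
  qed
  then show ?thesis by auto
qed

lemma closed_comp_id_rep_right:
  assumes Y: "t1_space Y" and R: "ambiguous_rep X Y R"
  shows "closed_comp X Y R (id_rep Y) = R"
proof -
  note I = ambiguous_rep_id_rep[OF Y]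
  have "(A, C) \<in> closed_comp X Y R (id_rep Y) \<longleftrightarrow> (A, C) \<in> R" for A C
  proof
    assume L: "(A, C) \<in> closed_comp X Y R (id_rep Y)"
    show "(A, C) \<in> R"
    proof (rule ambiguous_rep_closed[OF R])
      fix D assume "D \<in> hyperspace Y" "D \<inter> C = {}"
      with L obtain B C' where "(A, B) \<in> R" "(B, C') \<in> id_rep Y" "C' \<inter> D = {}"
        unfolding closed_comp_iff[OF R I] by blast
      \<comment> \<open>The intermediate \<open>B\<close> is a subset of \<open>C'\<close>, hence
        misses \<open>D\<close> as well.\<close>
      then show "\<exists>B'. (A, B') \<in> R \<and> B' \<inter> D = {}" unfolding id_rep_def by blast
    qed (use L closed_comp_iff[OF R I] in auto)
  next
    assume AC: "(A, C) \<in> R"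
    note h = ambiguous_rep_hyperspace[OF R AC]
    have "(C, C) \<in> id_rep Y" using h(2) by (simp add: id_rep_def)
    then show "(A, C) \<in> closed_comp X Y R (id_rep Y)"
      using AC h unfolding closed_comp_iff[OF R I] by (metis Int_commute)
  qed
  then show ?thesis by auto
qed

section \<open>The category and its contravariant involution\<close>

theorem mainTheorem4:
  "hom_category (compacta :: 'a topology set) pinv_hom pinv_comp id_rep \<and>
   involutive_contravariant_isomorphism
     (compacta :: 'a topology set) pinv_hom pinv_comp id_rep (\<lambda>X. X) smile"
proof (rule context_conjI)
  have t1: "t1_space X" if "X \<in> compacta" for X :: "'a topology"
    using that by (simp add: compacta_def Hausdorff_imp_t1_space)
  have id: "pseudo_invertible X X (id_rep X)" if "X \<in> compacta" for X :: "'a topology"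
    unfolding pseudo_invertible_def
    using ambiguous_rep_id_rep[OF t1[OF that]] smile_id_rep[OF t1[OF that]] by simp
  show C: "hom_category (compacta :: 'a topology set) pinv_hom pinv_comp id_rep"
  proof unfold_locales
    fix X Y Z W :: "'a topology" and f g h
    assume "f \<in> pinv_hom X Y" "g \<in> pinv_hom Y Z" "h \<in> pinv_hom Z W"
    then show "pinv_comp X Z W (pinv_comp X Y Z f g) h = pinv_comp X Y W f (pinv_comp Y Z W g h)"
      unfolding pinv_hom_def pinv_comp_def mem_Collect_eq
      using pseudo_invertibleD(1) by (intro closed_comp_assoc)
  qed (auto simp: pinv_hom_def pinv_comp_def id t1 closed_comp_id_rep_left
      closed_comp_id_rep_right pseudo_invertibleD(1) intro: pseudo_invertible_closed_comp)
  interpret hom_category "compacta :: 'a topology set" pinv_hom pinv_comp id_rep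
    by (fact C)
  show "involutive_contravariant_isomorphism
     (compacta :: 'a topology set) pinv_hom pinv_comp id_rep (\<lambda>X. X) smile"
  proof unfold_locales
    fix X Y :: "'a topology"
    show "bij_betw (smile X Y) (pinv_hom X Y) (pinv_hom Y X)"
      \<comment> \<open>Pseudo-inversion in the opposite direction is a two-sided inverse, as double
        pseudo-inversion fixes every arrow.\<close>
      by (rule bij_betw_byWitness[where f' = "smile Y X"])
        (auto simp: pinv_hom_def pseudo_invertible_smile pseudo_invertibleD(3))
  qed (auto simp: pinv_hom_def pinv_comp_def pseudo_invertible_smile smile_id_rep t1
      smile_closed_comp pseudo_invertibleD(3) bij_betw_def)
qed

end
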